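(* Let $j^{\max}$ be a finite natural number, let $I$ be the index set defined in the context equipped with the distance $\rho$ defined in the context, and let $W(\alpha,\beta)=\{\psi_i\}_{i\in I}$ be a wave packet system. Then $W(\alpha,\beta)$ is intrinsically localised (with $I\subset\mathbb Z^5\subset\mathbb R^5$, i.e. $d=5$).
   Context: Notation: $\mathbb N=\{1,2,\dots\}$, $\mathbb N_0=\mathbb N\cup\{0\}$; $\lceil x\rceil$ is the smallest integer $\geqslant x$; $|\cdot|$ is the Euclidean norm on $\mathbb R^2$; $\langle x,y\rangle=x_1y_1+x_2y_2$ for $x,y\in\mathbb R^2$; $\langle f\,|\,g\rangle$ is the $L^2(\mathbb R^2)$ scalar product of functions; $\mathrm i$ is the imaginary unit; $\hat f(\xi)=\int_{\mathbb R^2} f(t)e^{-2\pi \mathrm i\langle t,\xi\rangle}\,dt$. For a multi-index $a=(a_1,a_2)\in\mathbb N_0^2$, $|a|=a_1+a_2$. $f\lesssim g$ means $f\leqslant c\,g$ for some constant $c$ independent of the variables (here: of the point $\xi$, or of the indexes). Intrinsic localisation. Let $I\subset\mathbb R^d$ be a denumerable index set which is a metric space with a distance $\rho$ and is separated, i.e. $\inf_{i,i'\in I,\,i\neq i'}\rho(i,i')>0$, and let $n>d$. A set of functions $\{\psi_i\}_{i\in I}$ is said to be intrinsically localised if $|\langle\psi_i\,|\,\psi_{i'}\rangle|\lesssim(1+\rho(i,i'))^{-n}$ for all $i,i'\in I$ (with a constant independent of $i,i'$). Thus the assertion for $d=5$ is that $(I,\rho)$ is a separated denumerable metric space and that this estimate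 holds for some $n>5$. Index set. Let $0\leqslant\beta\leqslant\alpha<1$, $N:=10$, $j^{\max}\in\mathbb N$, $\delta>0$. For $j\in\mathbb N$ put $l_j^{\max}:=\lceil N\cdot 2^{(1-\beta)j}\rceil-1$ and, for $l\in\mathbb N_0$, $\theta_{jl}:=2\pi\cdot\frac{2^{(\beta-1)j}}{N}\cdot l$. For $l\leqslant l_j^{\max}$ let $m_{j,l}^{\max}:=\lceil 2^{(1-\alpha)j-1}\rceil-1$ if $j=j^{\max}$ or if $\theta_{jl}=\theta_{j+1,l'}$ for some $l'\in\mathbb N_0$ with $l'\leqslant l_{j+1}^{\max}$, and $m_{j,l}^{\max}:=\lceil 2^{(1-\alpha)j-1}\rceil$ otherwise. The index set is $$I:=\{(0,0,0,k):k\in\mathbb Z^2\}\cup\{(j,m,l,k)\in\mathbb N\times\mathbb N_0\times\mathbb N_0\times\mathbb Z^2: j\leqslant j^{\max},\ l\leqslant l_j^{\max},\ m\leqslant m_{j,l}^{\max}\}.$$ Matrices. $A_j=\begin{pmatrix}2^{\alpha j}&0\\0&2^{\beta j}\end{pmatrix}$, $B_{jm}=\begin{pmatrix}2^{j-1}+m\cdot2^{\alpha j}\\0\end{pmatrix}$, $R_{jl}=\begin{pmatrix}\cos\theta_{jl}&-\sin\theta_{jl}\\ \sin\theta_{jl}&\cos\theta_{jl}\end{pmatrix}$. Wave packet system. Let $p_0\in(0,1]$, $\kappa_0:=10+2p_0^{-1}$, $\epsilon\in(0,1/32)$, and let $\kappa\geqslant10$, $\kappa_1\geqslant2$, $\kappa_2\geqslant10$.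 Let $\gamma,\psi\in C^1(\mathbb R^2)$ be (complex-valued) prototype functions such that, for $f\in\{\gamma,\psi\}$: (1) $\partial^a f\in L^1(\mathbb R^2)\cap L^\infty(\mathbb R^2)$ for all $a\in\mathbb N_0^2$ with $|a|\leqslant1$; (2) $\sup_{t\in\mathbb R^2}(1+|t|)^{\kappa_0}|f(t)|<\infty$; (3) $\hat f\in C^\infty(\mathbb R^2)$, with $\hat\gamma(\xi)\neq0$ for all $\xi$ in the closed ball of radius $4$ centred at $0$, and $\hat\psi(\xi)\neq0$ for all $\xi\in[-\epsilon,1+\epsilon]\times[-1-\epsilon,1+\epsilon]$; (4) $|\partial^a\widehat{\partial^b f}(\xi)|\lesssim(1+|\xi|)^{-\kappa}(1+|\xi_1|)^{-\kappa_1}(1+|\xi_2|)^{-\kappa_2}$ for all $\xi=(\xi_1,\xi_2)\in\mathbb R^2$ and all $a,b\in\mathbb N_0^2$ with $|a|\leqslant12$, $|b|\leqslant1$. For $i=(j,m,l,k)\in I$ define $\psi_i(t):=\gamma(t-\delta k)$ if $(j,m,l)=(0,0,0)$, and $\psi_i(t):=|\det A_j|^{1/2}\,e^{-2\pi\mathrm i\langle R_{jl}B_{jm},t\rangle}\,(\psi\circ A_j\circ R_{jl}^{-1})(t-\delta R_{jl}A_j^{-1}k)$ if $(j,m,l)\neq(0,0,0)$. The set $W(\alpha,\beta):=\{\psi_i\}_{i\in I}$ is called the wave packet system. Distance. For $i=(j,m,l,k)\in I$ put: $r_i:=0$, $\theta_i:=0$, $t_i:=\delta k$ if $(j,m,l)=(0,0,0)$;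 and $r_i:=2^{j-1}+m\cdot2^{\alpha j}$, $\theta_i:=\theta_{jl}$, $t_i:=\delta R_{jl}A_j^{-1}k$ if $(j,m,l)\neq(0,0,0)$. For $i,i'\in I$, $$\rho(i,i'):=|r_i-r_{i'}|+|\theta_i-\theta_{i'}|+|(t_i-t_{i'})_1|+|(t_i-t_{i'})_2|,$$ where $(\cdot)_1,(\cdot)_2$ denote the Cartesian components of a vector in $\mathbb R^2$. *)

theory Defs
  imports "HOL-Analysis.Analysis"
begin

section \<open>Function spaces, derivatives and Fourier transform on the plane\<close>

definition partial_deriv :: "2 \<Rightarrow> (real^2 \<Rightarrow> complex) \<Rightarrow> real^2 \<Rightarrow> complex" where
  "partial_deriv n f x = vector_derivative (\<lambda>s. f (x + s *\<^sub>R axis n 1)) (at 0)"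

text \<open>The multi-index \<open>a = (a\<^sub>1, a\<^sub>2)\<close> acts as \<open>\<partial>\<^sub>1\<close> iterated \<open>a\<^sub>1\<close> times after \<open>\<partial>\<^sub>2\<close> iterated
  \<open>a\<^sub>2\<close> times. It is only ever applied to functions that are sufficiently often continuously
  differentiable, where the order is immaterial and \<^const>\<open>vector_derivative\<close> has its intended value.\<close>

definition multi_deriv :: "nat \<times> nat \<Rightarrow> (real^2 \<Rightarrow> complex) \<Rightarrow> real^2 \<Rightarrow> complex" where
  "multi_deriv a f = (partial_deriv 1 ^^ fst a) ((partial_deriv 2 ^^ snd a) f)"

abbreviation multi_size :: "nat \<times> nat \<Rightarrow> nat" where
  "multi_size a \<equiv> fst a + snd a"

fun C_k :: "nat \<Rightarrow> (real^2 \<Rightarrow> complex) \<Rightarrow> bool" where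
  "C_k 0 f \<longleftrightarrow> continuous_on UNIV f"
| "C_k (Suc k) f \<longleftrightarrow> (\<forall>x. f differentiable (at x)) \<and> (\<forall>n. C_k k (partial_deriv n f))"

definition C_infinity :: "(real^2 \<Rightarrow> complex) \<Rightarrow> bool" where
  "C_infinity f \<longleftrightarrow> (\<forall>k. C_k k f)"

definition in_L1 :: "(real^2 \<Rightarrow> complex) \<Rightarrow> bool" where
  "in_L1 f \<longleftrightarrow> integrable lborel f"

definition in_L2 :: "(real^2 \<Rightarrow> complex) \<Rightarrow> bool" where
  "in_L2 f \<longleftrightarrow> f \<in> borel_measurable lborel \<and> integrable lborel (\<lambda>t. (norm (f t))\<^sup>2)"

definition in_L_infinity :: "(real^2 \<Rightarrow> complex) \<Rightarrow> bool" where
  "in_L_infinity f \<longleftrightarrow> f \<in> borel_measurable lborel \<and> (\<exists>C. AE t in lborel. norm (f t) \<le> C)"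

definition L2_inner :: "(real^2 \<Rightarrow> complex) \<Rightarrow> (real^2 \<Rightarrow> complex) \<Rightarrow> complex" where
  "L2_inner f g = (LINT t|lborel. f t * cnj (g t))"

definition fourier :: "(real^2 \<Rightarrow> complex) \<Rightarrow> real^2 \<Rightarrow> complex" where
  "fourier f \<xi> = (LINT t|lborel. f t * exp (- 2 * pi * \<i> * of_real (t \<bullet> \<xi>)))"


section \<open>Intrinsic localisation\<close>

text \<open>The index set \<open>I\<close> is regarded as a subset of the Euclidean space \<open>'a\<close> by means of the
  embedding \<open>\<iota>\<close>; the dimension \<open>d\<close> is \<open>DIM('a)\<close>. Membership in \<open>L\<^sup>2\<close> makes the scalar
  products meaningful (the Bochner integral of a non-integrable function is 0).\<close>

definition intrinsically_localised ::
    "('i \<Rightarrow> 'a::euclidean_space) \<Rightarrow> 'i set \<Rightarrow> ('i \<Rightarrow> 'i \<Rightarrow> real) \<Rightarrow> ('i \<Rightarrow> real^2 \<Rightarrow> complex) \<Rightarrow> bool" where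
  "intrinsically_localised \<iota> I \<rho> \<Psi> \<longleftrightarrow>
     inj_on \<iota> I \<and> countable I \<and> infinite I \<and>
     Metric_space I \<rho> \<and>
     0 < (INF (i, i') \<in> {(i, i'). i \<in> I \<and> i' \<in> I \<and> i \<noteq> i'}. \<rho> i i') \<and>
     (\<forall>i\<in>I. in_L2 (\<Psi> i)) \<and>
     (\<exists>n::real. n > real DIM('a) \<and>
        (\<exists>c. \<forall>i\<in>I. \<forall>i'\<in>I. norm (L2_inner (\<Psi> i) (\<Psi> i')) \<le> c * (1 + \<rho> i i') powr (- n)))"


section \<open>The index set\<close>

text \<open>An index \<open>(j, m, l, k)\<close> with \<open>k = (k\<^sub>1, k\<^sub>2) \<in> \<int>\<^sup>2\<close>.\<close>

type_synonym wp_index = "nat \<times> nat \<times> nat \<times> (int \<times> int)"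

definition index_embedding :: "wp_index \<Rightarrow> real^5" where
  "index_embedding = (\<lambda>(j, m, l, (k1, k2)).
     vector [of_nat j, of_nat m, of_nat l, of_int k1, of_int k2])"

definition N_const :: nat where "N_const = 10"

text \<open>The ceilings below are at least 1, so the subtractions on natural numbers do not truncate.\<close>

definition l_max :: "real \<Rightarrow> nat \<Rightarrow> nat" where
  "l_max \<beta> j = nat \<lceil>real N_const * 2 powr ((1 - \<beta>) * real j)\<rceil> - 1"

definition theta :: "real \<Rightarrow> nat \<Rightarrow> nat \<Rightarrow> real" where
  "theta \<beta> j l = 2 * pi * (2 powr ((\<beta> - 1) * real j) / real N_const) * real l"

definition m_max :: "real \<Rightarrow> real \<Rightarrow> nat \<Rightarrow> nat \<Rightarrow> nat \<Rightarrow> nat" where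
  "m_max \<alpha> \<beta> jmax j l =
     (if j = jmax \<or> (\<exists>l'. l' \<le> l_max \<beta> (j + 1) \<and> theta \<beta> j l = theta \<beta> (j + 1) l')
      then nat \<lceil>2 powr ((1 - \<alpha>) * real j - 1)\<rceil> - 1
      else nat \<lceil>2 powr ((1 - \<alpha>) * real j - 1)\<rceil>)"

definition index_set :: "real \<Rightarrow> real \<Rightarrow> nat \<Rightarrow> wp_index set" where
  "index_set \<alpha> \<beta> jmax =
     {(0, 0, 0, k) | k. True} \<union>
     {(j, m, l, k) | j m l k. 1 \<le> j \<and> j \<le> jmax \<and> l \<le> l_max \<beta> j \<and> m \<le> m_max \<alpha> \<beta> jmax j l}"


section \<open>The wave packet system\<close>

definition A_mat :: "real \<Rightarrow> real \<Rightarrow> nat \<Rightarrow> real^2^2" where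
  "A_mat \<alpha> \<beta> j = vector [vector [2 powr (\<alpha> * real j), 0], vector [0, 2 powr (\<beta> * real j)]]"

definition B_vec :: "real \<Rightarrow> nat \<Rightarrow> nat \<Rightarrow> real^2" where
  "B_vec \<alpha> j m = vector [2 powr (real j - 1) + real m * 2 powr (\<alpha> * real j), 0]"

definition R_mat :: "real \<Rightarrow> nat \<Rightarrow> nat \<Rightarrow> real^2^2" where
  "R_mat \<beta> j l = vector [vector [cos (theta \<beta> j l), - sin (theta \<beta> j l)],
                         vector [sin (theta \<beta> j l), cos (theta \<beta> j l)]]"

definition lattice_pt :: "int \<times> int \<Rightarrow> real^2" where
  "lattice_pt k = vector [of_int (fst k), of_int (snd k)]"

definition t_pt :: "real \<Rightarrow> real \<Rightarrow> real \<Rightarrow> wp_index \<Rightarrow> real^2" where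
  "t_pt \<alpha> \<beta> \<delta> = (\<lambda>(j, m, l, k).
     if (j, m, l) = (0, 0, 0) then \<delta> *\<^sub>R lattice_pt k
     else \<delta> *\<^sub>R (R_mat \<beta> j l *v (matrix_inv (A_mat \<alpha> \<beta> j) *v lattice_pt k)))"

definition r_pt :: "real \<Rightarrow> wp_index \<Rightarrow> real" where
  "r_pt \<alpha> = (\<lambda>(j, m, l, k).
     if (j, m, l) = (0, 0, 0) then 0
     else 2 powr (real j - 1) + real m * 2 powr (\<alpha> * real j))"

definition theta_pt :: "real \<Rightarrow> wp_index \<Rightarrow> real" where
  "theta_pt \<beta> = (\<lambda>(j, m, l, k). if (j, m, l) = (0, 0, 0) then 0 else theta \<beta> j l)"

definition rho :: "real \<Rightarrow> real \<Rightarrow> real \<Rightarrow> wp_index \<Rightarrow> wp_index \<Rightarrow> real" where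
  "rho \<alpha> \<beta> \<delta> i i' =
     \<bar>r_pt \<alpha> i - r_pt \<alpha> i'\<bar> + \<bar>theta_pt \<beta> i - theta_pt \<beta> i'\<bar>
     + \<bar>(t_pt \<alpha> \<beta> \<delta> i - t_pt \<alpha> \<beta> \<delta> i') $ 1\<bar> + \<bar>(t_pt \<alpha> \<beta> \<delta> i - t_pt \<alpha> \<beta> \<delta> i') $ 2\<bar>"

definition wave_packet ::
    "real \<Rightarrow> real \<Rightarrow> real \<Rightarrow> (real^2 \<Rightarrow> complex) \<Rightarrow> (real^2 \<Rightarrow> complex) \<Rightarrow> wp_index \<Rightarrow> real^2 \<Rightarrow> complex" where
  "wave_packet \<alpha> \<beta> \<delta> \<gamma> \<psi> = (\<lambda>(j, m, l, k) t.
     if (j, m, l) = (0, 0, 0) then \<gamma> (t - \<delta> *\<^sub>R lattice_pt k)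
     else of_real (sqrt \<bar>det (A_mat \<alpha> \<beta> j)\<bar>)
          * exp (- 2 * pi * \<i> * of_real ((R_mat \<beta> j l *v B_vec \<alpha> j m) \<bullet> t))
          * \<psi> (A_mat \<alpha> \<beta> j *v (matrix_inv (R_mat \<beta> j l) *v
                (t - \<delta> *\<^sub>R (R_mat \<beta> j l *v (matrix_inv (A_mat \<alpha> \<beta> j) *v lattice_pt k))))))"

definition fourier_decay :: "real \<Rightarrow> real \<Rightarrow> real \<Rightarrow> (real^2 \<Rightarrow> complex) \<Rightarrow> bool" where
  "fourier_decay \<kappa> \<kappa>1 \<kappa>2 f \<longleftrightarrow>
     (\<forall>a b. multi_size a \<le> 12 \<and> multi_size b \<le> 1 \<longrightarrow>
        (\<exists>c. \<forall>\<xi>. norm (multi_deriv a (fourier (multi_deriv b f)) \<xi>)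
              \<le> c * (1 + norm \<xi>) powr (- \<kappa>) * (1 + \<bar>\<xi> $ 1\<bar>) powr (- \<kappa>1) * (1 + \<bar>\<xi> $ 2\<bar>) powr (- \<kappa>2)))"

end

theory Submission
  imports Defs
begin

text \<open>Because \<open>jmax\<close> is finite, only finitely many triples \<open>(j, m, l)\<close> occur, so the radial and
  angular parts of the distance \<open>\<rho>\<close> are bounded, and up to constants \<open>1 + \<rho>\<close> is at most \<open>1 + d\<close>,
  where \<open>d\<close> is the distance of the spatial centres. For the same reason all wave packets inherit the
  decay \<open>(1 + |t - t\<^sub>i|)\<^bsup>-12\<^esup>\<close> of the prototypes with one constant. From
  \<open>1 + |t\<^sub>i - t\<^sub>i\<^sub>'| \<le> (1 + |t - t\<^sub>i|) (1 + |t - t\<^sub>i\<^sub>'|)\<close> the product of two wave packets is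
  \<open>O((1 + d)\<^bsup>-8\<^esup> (1 + |t - t\<^sub>i|)\<^bsup>-4\<^esup>)\<close>, and integration gives the estimate with \<open>n = 8 > 5\<close>.
  The triple is determined by radius and angle, and for a fixed triple the centres form a lattice,
  hence \<open>\<rho>\<close> is a metric and \<open>I\<close> is separated.\<close>

section \<open>Scalar products of decaying functions\<close>

text \<open>The antiderivative \<open>arctan\<close> has finite limits at both ends of the line, so
  for this nonnegative integrand the improper fundamental theorem already yields
  integrability.\<close>

lemma integrable_inverse_one_plus_square:
  "integrable lborel (\<lambda>x::real. inverse (1 + x\<^sup>2))"
proof -
  have "set_integrable lborel (einterval (-\<infinity>) \<infinity>) (\<lambda>x::real. inverse (1 + x\<^sup>2))"
  proof (rule interval_integral_FTC_nonneg[where F = arctan and A = "- pi / 2" and B = "pi / 2"])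
    show "((arctan \<circ> real_of_ereal) \<longlongrightarrow> - pi / 2) (at_right (-\<infinity>))"
      using tendsto_arctan_at_bot by (simp add: ereal_tendsto_simps1)
    show "((arctan \<circ> real_of_ereal) \<longlongrightarrow> pi / 2) (at_left \<infinity>)"
      using tendsto_arctan_at_top by (simp add: ereal_tendsto_simps1)
    show "isCont (\<lambda>x. inverse (1 + x\<^sup>2)) x" for x :: real
    proof -
      have "1 + x\<^sup>2 \<noteq> 0"
        by (metis add_pos_nonneg less_irrefl zero_le_power2 zero_less_one)
      then show ?thesis by (intro continuous_intros) auto
    qed
  qed (auto intro!: DERIV_arctan)
  then show ?thesis
    by (simp add: set_integrable_def einterval_eq_UNIV)
qed

text \<open>One factor \<open>(1 + norm t)\<^sup>2\<close> is spent on each coordinate, where it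
  dominates \<open>1 + (t \<bullet> b)\<^sup>2\<close>. The majorant is a product of one-variable
  functions, so Tonelli reduces the claim to the line. In the plane the exponent is 4.\<close>

lemma integrable_inverse_power_norm:
  "integrable lborel (\<lambda>t::'a::euclidean_space. inverse ((1 + norm t) ^ (2 * DIM('a))))"
proof (rule integrableI_bounded)
  show "(\<lambda>t::'a. inverse ((1 + norm t) ^ (2 * DIM('a)))) \<in> borel_measurable lborel"
    by measurable
  have le: "inverse ((1 + norm t) ^ (2 * DIM('a))) \<le> (\<Prod>b\<in>Basis. inverse (1 + (t \<bullet> b)\<^sup>2))"
    for t :: 'a
  proof -
    have "inverse ((1 + norm t)\<^sup>2) \<le> inverse (1 + (t \<bullet> b)\<^sup>2)" if "b \<in> Basis" for b
    proof (rule le_imp_inverse_le)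
      have "(t \<bullet> b)\<^sup>2 \<le> (norm t)\<^sup>2"
        using Basis_le_norm[OF that, of t] by (simp flip: abs_le_square_iff)
      then show "1 + (t \<bullet> b)\<^sup>2 \<le> (1 + norm t)\<^sup>2"
        using norm_ge_zero[of t] by (simp add: power2_sum del: norm_ge_zero)
    qed (simp add: add_pos_nonneg)
    then have "(\<Prod>b\<in>(Basis::'a set). inverse ((1 + norm t)\<^sup>2))
        \<le> (\<Prod>b\<in>Basis. inverse (1 + (t \<bullet> b)\<^sup>2))"
      by (intro prod_mono) auto
    then show ?thesis by (simp add: power_mult power_inverse)
  qed
  have "(\<integral>\<^sup>+ t. ennreal (norm (inverse ((1 + norm t) ^ (2 * DIM('a))))) \<partial>(lborel :: 'a measure))
      \<le> (\<integral>\<^sup>+ t. (\<Prod>b\<in>Basis. ennreal (inverse (1 + (t \<bullet> b)\<^sup>2))) \<partial>(lborel :: 'a measure))"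
    using le by (intro nn_integral_mono) (auto simp: prod_ennreal ennreal_leI)
  also have "\<dots> = (\<Prod>b\<in>(Basis::'a set). \<integral>\<^sup>+ x. ennreal (inverse (1 + x\<^sup>2)) \<partial>lborel)"
    by (rule nn_integral_lborel_prod) auto
  also have "\<dots> < \<infinity>"
    using integrable_inverse_one_plus_square
    by (auto simp: integrable_iff_bounded ennreal_prod_eq_top power_less_top_ennreal)
  finally show "(\<integral>\<^sup>+ t. ennreal (norm (inverse ((1 + norm t) ^ (2 * DIM('a))))) \<partial>(lborel :: 'a measure)) < \<infinity>" .
qed

lemma integrable_inverse_power_norm_shift:
  fixes a :: "real^2"
  shows "integrable lborel (\<lambda>t. inverse ((1 + norm (t - a)) ^ 4))"
    and "(LINT t|lborel. inverse ((1 + norm (t - a)) ^ 4))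
       = (LINT t|(lborel :: (real^2) measure). inverse ((1 + norm t) ^ 4))"
proof -
  let ?g = "\<lambda>t::real^2. inverse ((1 + norm t) ^ 4)"
  have g: "integrable lborel ?g"
    using integrable_inverse_power_norm[where 'a = "real^2"] by simp
  have d: "distr lborel borel ((+) (- a)) = lborel"
    by (rule lborel_distr_plus)
  have "integrable (distr lborel borel ((+) (- a))) ?g"
    using g by (simp only: d)
  then have "integrable lborel (\<lambda>t. ?g (- a + t))"
    by (subst (asm) integrable_distr_eq) auto
  then show "integrable lborel (\<lambda>t. ?g (t - a))" by simp
  have "(LINT t|distr lborel borel ((+) (- a)). ?g t) = (LINT t|lborel. ?g (- a + t))"
    by (rule integral_distr) auto
  then show "(LINT t|lborel. ?g (t - a)) = (LINT t|lborel. ?g t)"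
    by (simp only: d) simp
qed

text \<open>Of the twelve powers of decay, eight are spent on \<open>d \<le> x * y\<close> and four
  on \<open>x \<le> x * y\<close>. The first produce decay in the distance of the centres, the
  second leave an integrable weight around \<open>a\<close>.\<close>

lemma norm_L2_inner_le:
  fixes f g :: "real^2 \<Rightarrow> complex"
  assumes f: "\<And>t. norm (f t) \<le> C * inverse ((1 + norm (t - a)) ^ 12)"
    and g: "\<And>t. norm (g t) \<le> C * inverse ((1 + norm (t - b)) ^ 12)"
  shows "norm (L2_inner f g) \<le>
    C\<^sup>2 * (LINT t|(lborel :: (real^2) measure). inverse ((1 + norm t) ^ 4))
        * inverse ((1 + norm (a - b)) ^ 8)"
proof -
  have pt: "norm (f t * cnj (g t)) \<le>
      C\<^sup>2 * inverse ((1 + norm (a - b)) ^ 8) * inverse ((1 + norm (t - a)) ^ 4)" for t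
  proof -
    define x y d where "x = 1 + norm (t - a)" and "y = 1 + norm (t - b)" and "d = 1 + norm (a - b)"
    have pos: "1 \<le> x" "1 \<le> y" "1 \<le> d" by (auto simp: x_def y_def d_def)
    have "norm (a - b) \<le> norm (t - a) + norm (t - b)"
      by (metis dist_norm dist_triangle3)
    \<comment> \<open>The triangle inequality bounds \<open>d\<close> by 1 + (x - 1) + (y - 1),
      which falls short of \<open>x * y\<close> by the nonnegative product of x - 1 and y -
      1.\<close>
    then have "d \<le> x * y"
      by (simp add: x_def y_def d_def algebra_simps)
        (smt (verit) mult_nonneg_nonneg norm_ge_zero)
    then have "d ^ 8 \<le> (x * y) ^ 8" using pos by (intro power_mono) auto
    moreover have "x ^ 4 \<le> (x * y) ^ 4" using pos by (intro power_mono) auto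
    ultimately have "d ^ 8 * x ^ 4 \<le> (x * y) ^ 8 * (x * y) ^ 4"
      using pos by (intro mult_mono) auto
    also have "\<dots> = x ^ 12 * y ^ 12" by (simp flip: power_add power_mult_distrib)
    finally have le: "inverse (x ^ 12 * y ^ 12) \<le> inverse (d ^ 8 * x ^ 4)"
      using pos by (intro le_imp_inverse_le) auto
    have "norm (f t * cnj (g t)) \<le> (C * inverse (x ^ 12)) * (C * inverse (y ^ 12))"
      unfolding norm_mult complex_mod_cnj x_def y_def
      \<comment> \<open>The sign of \<open>C\<close> is not assumed; the upper bound for
        \<open>f\<close> is nonnegative because it dominates a norm.\<close>
      by (rule mult_mono[OF f g]) (auto intro: order_trans[OF norm_ge_zero f])
    also have "\<dots> = C\<^sup>2 * inverse (x ^ 12 * y ^ 12)"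
      by (simp add: power2_eq_square)
    also have "\<dots> \<le> C\<^sup>2 * inverse (d ^ 8 * x ^ 4)"
      by (rule mult_left_mono[OF le]) simp
    finally show ?thesis by (simp add: d_def x_def)
  qed
  have "norm (L2_inner f g) \<le>
      (LINT t|lborel. C\<^sup>2 * inverse ((1 + norm (a - b)) ^ 8) * inverse ((1 + norm (t - a)) ^ 4))"
    unfolding L2_inner_def
    by (rule order_trans[OF integral_norm_bound Bochner_Integration.integral_mono'])
      (use pt integrable_inverse_power_norm_shift in auto)
  then show ?thesis
    by (simp add: integrable_inverse_power_norm_shift mult_ac)
qed

lemma in_L2_of_decay:
  fixes f :: "real^2 \<Rightarrow> complex"
  assumes f: "\<And>t. norm (f t) \<le> C * inverse ((1 + norm (t - a)) ^ 12)"
    and cont: "continuous_on UNIV f"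
  shows "in_L2 f"
proof -
  have meas: "f \<in> borel_measurable borel"
    using cont by (rule borel_measurable_continuous_onI)
  have "integrable lborel (\<lambda>t. (norm (f t))\<^sup>2)"
  proof (rule Bochner_Integration.integrable_bound)
    show "integrable lborel (\<lambda>t. C\<^sup>2 * inverse ((1 + norm (t - a)) ^ 4))"
      using integrable_inverse_power_norm_shift by simp
    have "(norm (f t))\<^sup>2 \<le> C\<^sup>2 * inverse ((1 + norm (t - a)) ^ 4)" for t
    proof -
      have "(norm (f t))\<^sup>2 \<le> (C * inverse ((1 + norm (t - a)) ^ 12))\<^sup>2"
        by (intro power_mono f) simp
      also have "\<dots> = C\<^sup>2 * inverse ((1 + norm (t - a)) ^ 24)"
        by (simp add: power_mult_distrib power_inverse flip: power_mult)
      \<comment> \<open>Squaring gives exponent 24, which is lowered to the integrable exponent 4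
        since the base is at least 1.\<close>
      also have "\<dots> \<le> C\<^sup>2 * inverse ((1 + norm (t - a)) ^ 4)"
        by (intro mult_left_mono le_imp_inverse_le power_increasing zero_less_power add_pos_nonneg)
          auto
      finally show ?thesis .
    qed
    then show "AE t in lborel. norm ((norm (f t))\<^sup>2) \<le> norm (C\<^sup>2 * inverse ((1 + norm (t - a)) ^ 4))"
      by auto
  qed (use meas in measurable)
  with meas show ?thesis by (simp add: in_L2_def)
qed

section \<open>Geometry of the index set\<close>

lemma norm_R_mat [simp]: "norm (R_mat \<beta> j l *v v) = norm v"
proof -
  let ?c = "cos (theta \<beta> j l)" and ?s = "sin (theta \<beta> j l)"
  have "(norm (R_mat \<beta> j l *v v))\<^sup>2 = (?c * v $ 1 - ?s * v $ 2)\<^sup>2 + (?s * v $ 1 + ?c * v $ 2)\<^sup>2"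
    unfolding power2_norm_eq_inner
    by (simp add: inner_vec_def sum_2 R_mat_def matrix_vector_mult_def power2_eq_square)
  also have "\<dots> = (?s\<^sup>2 + ?c\<^sup>2) * ((v $ 1)\<^sup>2 + (v $ 2)\<^sup>2)"
    by algebra
  also have "\<dots> = (norm v)\<^sup>2"
    unfolding power2_norm_eq_inner sin_cos_squared_add by (simp add: inner_vec_def sum_2 power2_eq_square)
  finally show ?thesis by simp
qed

lemma matrix_inv_right:
  fixes A :: "'a::semiring_1^'n^'m"
  assumes "invertible A"
  shows "A ** matrix_inv A = mat 1"
  \<comment> \<open>\<open>matrix_inv\<close> is a Hilbert choice among two-sided inverses;
    invertibility says that one exists.\<close>
  using someI_ex[OF assms[unfolded invertible_def]] by (simp add: matrix_inv_def)

lemma R_mat_inverse [simp]: "R_mat \<beta> j l *v (matrix_inv (R_mat \<beta> j l) *v v) = v"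
proof -
  have "det (R_mat \<beta> j l) = 1"
    using sin_cos_squared_add2[of "theta \<beta> j l"]
    by (simp add: det_2 R_mat_def power2_eq_square)
  then show ?thesis
    by (simp add: matrix_vector_mul_assoc matrix_inv_right invertible_det_nz)
qed

lemma norm_R_mat_inv [simp]: "norm (matrix_inv (R_mat \<beta> j l) *v v) = norm v"
  by (metis norm_R_mat R_mat_inverse)

lemma A_mat_inverse [simp]: "A_mat \<alpha> \<beta> j *v (matrix_inv (A_mat \<alpha> \<beta> j) *v v) = v"
proof -
  have "det (A_mat \<alpha> \<beta> j) \<noteq> 0"
    by (simp add: det_2 A_mat_def)
  then show ?thesis
    by (simp add: matrix_vector_mul_assoc matrix_inv_right invertible_det_nz)
qed

lemma A_mat_mult:
  "(A_mat \<alpha> \<beta> j *v v) $ 1 = 2 powr (\<alpha> * real j) * v $ 1"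
  "(A_mat \<alpha> \<beta> j *v v) $ 2 = 2 powr (\<beta> * real j) * v $ 2"
  by (simp_all add: A_mat_def matrix_vector_mult_def sum_2)

lemma norm_real2_mono:
  fixes v w :: "real^2"
  assumes "\<bar>v $ 1\<bar> \<le> \<bar>w $ 1\<bar>" "\<bar>v $ 2\<bar> \<le> \<bar>w $ 2\<bar>"
  shows "norm v \<le> norm w"
proof (rule power2_le_imp_le)
  have "(v $ 1)\<^sup>2 \<le> (w $ 1)\<^sup>2" "(v $ 2)\<^sup>2 \<le> (w $ 2)\<^sup>2"
    using assms by (simp_all flip: abs_le_square_iff)
  then show "(norm v)\<^sup>2 \<le> (norm w)\<^sup>2"
    unfolding power2_norm_eq_inner inner_vec_def sum_2 by (simp add: power2_eq_square)
qed simp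

lemma norm_le_norm_A_mat:
  assumes "0 \<le> \<alpha>" "0 \<le> \<beta>"
  shows "norm v \<le> norm (A_mat \<alpha> \<beta> j *v v)"
proof (rule norm_real2_mono)
  have "1 \<le> 2 powr (\<alpha> * real j)" "1 \<le> 2 powr (\<beta> * real j)"
    using assms by (simp_all add: ge_one_powr_ge_zero)
  then show "\<bar>v $ 1\<bar> \<le> \<bar>(A_mat \<alpha> \<beta> j *v v) $ 1\<bar>" "\<bar>v $ 2\<bar> \<le> \<bar>(A_mat \<alpha> \<beta> j *v v) $ 2\<bar>"
    by (simp_all add: A_mat_mult abs_mult mult_le_cancel_right1)
qed

text \<open>Both diagonal entries are at most 2^j. This crude bound on the expansion controls from
  below how far \<open>matrix_inv (A_mat \<alpha> \<beta> j)\<close> can contract the integer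
  lattice.\<close>

lemma norm_A_mat_le:
  assumes "\<alpha> \<le> 1" "\<beta> \<le> 1"
  shows "norm (A_mat \<alpha> \<beta> j *v v) \<le> 2 ^ j * norm v"
proof -
  have "c * real j \<le> real j" if "c \<le> 1" for c
    using mult_right_mono[OF that, of "real j"] by simp
  then have "2 powr (\<alpha> * real j) \<le> 2 powr real j" "2 powr (\<beta> * real j) \<le> 2 powr real j"
    using assms by auto
  then have "norm (A_mat \<alpha> \<beta> j *v v) \<le> norm ((2 ^ j :: real) *\<^sub>R v)"
    by (intro norm_real2_mono)
      (auto simp: A_mat_mult abs_mult powr_realpow intro!: mult_right_mono)
  then show ?thesis by simp
qed

section \<open>Index triples and spatial centres\<close>

lemma index_set_iff:
  "(j, m, l, k) \<in> index_set \<alpha> \<beta> jmax \<longleftrightarrow>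
     (j = 0 \<and> m = 0 \<and> l = 0) \<or>
     (1 \<le> j \<and> j \<le> jmax \<and> l \<le> l_max \<beta> j \<and> m \<le> m_max \<alpha> \<beta> jmax j l)"
  by (auto simp: index_set_def)

lemma finite_index_triples:
  "finite ((\<lambda>(j, m, l, k). (j, m, l)) ` index_set \<alpha> \<beta> jmax)"
proof (rule finite_subset)
  show "(\<lambda>(j, m, l, k). (j, m, l)) ` index_set \<alpha> \<beta> jmax \<subseteq>
     insert (0, 0, 0) (\<Union>j\<in>{..jmax}. \<Union>l\<in>{..l_max \<beta> j}. (\<lambda>m. (j, m, l)) ` {..m_max \<alpha> \<beta> jmax j l})"
    by (force simp: index_set_iff)
qed auto

text \<open>Membership with j = 0 forces m = l = 0, where both matrices are the identity. The
  general formula therefore covers the coarse layer too, and later arguments need no case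
  distinction.\<close>

lemma t_pt_eq:
  assumes "(j, m, l, k) \<in> index_set \<alpha> \<beta> jmax"
  shows "t_pt \<alpha> \<beta> \<delta> (j, m, l, k) =
    \<delta> *\<^sub>R (R_mat \<beta> j l *v (matrix_inv (A_mat \<alpha> \<beta> j) *v lattice_pt k))"
proof (cases "j = 0")
  case True
  then have z: "m = 0" "l = 0" using assms by (auto simp: index_set_iff)
  have "R_mat \<beta> 0 0 *v v = v" for v
    by (simp add: R_mat_def theta_def vec_eq_iff forall_2 matrix_vector_mult_def sum_2)
  moreover have "A_mat \<alpha> \<beta> 0 *v v = v" for v
    by (simp add: vec_eq_iff forall_2 A_mat_mult)
  then have "matrix_inv (A_mat \<alpha> \<beta> 0) *v v = v" for v
    by (metis A_mat_inverse)
  ultimately show ?thesis using True z by (simp add: t_pt_def)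
qed (simp add: t_pt_def)

text \<open>The difference of the centres is a rotated and scaled copy of \<open>w\<close>, the
  preimage under the dilation of a nonzero integer vector. That vector has length at least 1, and
  the dilation expands by at most 2^jmax.\<close>

lemma norm_t_pt_diff_ge:
  assumes "\<alpha> \<le> 1" "\<beta> \<le> 1" "0 < \<delta>"
    and i: "(j, m, l, k) \<in> index_set \<alpha> \<beta> jmax" "(j, m, l, k') \<in> index_set \<alpha> \<beta> jmax"
    and "k \<noteq> k'"
  shows "\<delta> / 2 ^ jmax \<le> norm (t_pt \<alpha> \<beta> \<delta> (j, m, l, k) - t_pt \<alpha> \<beta> \<delta> (j, m, l, k'))"
proof -
  define v where "v = lattice_pt k - lattice_pt k'"
  define w where "w = matrix_inv (A_mat \<alpha> \<beta> j) *v v"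
  have "1 \<le> norm v"
  proof (cases "fst k = fst k'")
    case True
    then have "1 \<le> \<bar>snd k - snd k'\<bar>" using \<open>k \<noteq> k'\<close> by (auto simp: prod_eq_iff)
    then have "1 \<le> \<bar>v $ 2\<bar>" by (simp add: v_def lattice_pt_def flip: of_int_diff of_int_abs)
    then show ?thesis using component_le_norm_cart[of v 2] by linarith
  next
    case False
    then have "1 \<le> \<bar>fst k - fst k'\<bar>" by auto
    then have "1 \<le> \<bar>v $ 1\<bar>" by (simp add: v_def lattice_pt_def flip: of_int_diff of_int_abs)
    then show ?thesis using component_le_norm_cart[of v 1] by linarith
  qed
  also have "norm v = norm (A_mat \<alpha> \<beta> j *v w)" by (simp add: w_def)
  also have "\<dots> \<le> 2 ^ j * norm w" using assms by (intro norm_A_mat_le)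
  also have "\<dots> \<le> 2 ^ jmax * norm w"
    using i by (intro mult_right_mono power_increasing) (auto simp: index_set_iff)
  finally have "1 / 2 ^ jmax \<le> norm w" by (simp add: field_simps)
  then have "\<delta> * (1 / 2 ^ jmax) \<le> \<delta> * norm w" using \<open>0 < \<delta>\<close> by (intro mult_left_mono) auto
  moreover have "t_pt \<alpha> \<beta> \<delta> (j, m, l, k) - t_pt \<alpha> \<beta> \<delta> (j, m, l, k') = \<delta> *\<^sub>R (R_mat \<beta> j l *v w)"
    by (simp add: t_pt_eq[OF i(1)] t_pt_eq[OF i(2)] w_def v_def
        matrix_vector_mult_diff_distrib scaleR_diff_right)
  ultimately show ?thesis using \<open>0 < \<delta>\<close> by simp
qed

section \<open>Radius and angle determine the triple\<close>

lemma theta_inj: "theta \<beta> j l = theta \<beta> j l' \<longleftrightarrow> l = l'"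
  by (auto simp: theta_def N_const_def)

lemma r_pt_ge:
  assumes "1 \<le> j"
  shows "2 powr (real j - 1) \<le> r_pt \<alpha> (j, m, l, k)"
  using assms by (simp add: r_pt_def)

text \<open>The dyadic shell from 2^(j-1) to 2^j is filled by exactly this many, possibly
  fractionally many, radial steps of length \<open>2 powr (\<alpha> * real j)\<close>.\<close>

lemma scale_split:
  "2 powr (real j - 1) + 2 powr ((1 - \<alpha>) * real j - 1) * 2 powr (\<alpha> * real j) = 2 powr real j"
proof -
  have "2 powr ((1 - \<alpha>) * real j - 1) * 2 powr (\<alpha> * real j) = 2 powr (real j - 1)"
    by (simp add: algebra_simps flip: powr_add)
  then show ?thesis by (simp add: powr_diff)
qed

text \<open>Rounding up overshoots the shell by at most one radial step, and that step is shorter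
  than 2^j because \<alpha> < 1 and j is positive.\<close>

lemma r_pt_less:
  assumes "\<alpha> < 1" "1 \<le> j" "m \<le> m_max \<alpha> \<beta> jmax j l"
  shows "r_pt \<alpha> (j, m, l, k) < 2 powr (real j + 1)"
proof -
  define x where "x = 2 powr ((1 - \<alpha>) * real j - 1)"
  have "m \<le> nat \<lceil>x\<rceil>" using assms(3) by (auto simp: m_max_def x_def split: if_splits)
  moreover have "0 < x" by (simp add: x_def)
  ultimately have "real m \<le> real_of_int \<lceil>x\<rceil>" by linarith
  then have "real m \<le> x + 1" by linarith
  then have "real m * 2 powr (\<alpha> * real j) \<le> (x + 1) * 2 powr (\<alpha> * real j)"
    by (rule mult_right_mono) simp
  then have "r_pt \<alpha> (j, m, l, k) \<le> 2 powr real j + 2 powr (\<alpha> * real j)"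
    using scale_split[of j \<alpha>] assms(2) by (simp add: r_pt_def x_def algebra_simps)
  also have "\<dots> < 2 powr real j + 2 powr real j"
    using assms by simp
  also have "\<dots> = 2 powr (real j + 1)" by (simp add: powr_add)
  finally show ?thesis .
qed

lemma r_pt_less_match:
  assumes "1 \<le> j" "m \<le> m_max \<alpha> \<beta> jmax j l"
    and "l' \<le> l_max \<beta> (j + 1)" "theta \<beta> j l = theta \<beta> (j + 1) l'"
  shows "r_pt \<alpha> (j, m, l, k) < 2 powr real j"
proof -
  define x where "x = 2 powr ((1 - \<alpha>) * real j - 1)"
  have "\<exists>l'. l' \<le> l_max \<beta> (j + 1) \<and> theta \<beta> j l = theta \<beta> (j + 1) l'"
    using assms(3,4) by blast
  then have "m_max \<alpha> \<beta> jmax j l = nat \<lceil>x\<rceil> - 1"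
    unfolding m_max_def x_def by (intro if_P disjI2)
  then have "m \<le> nat \<lceil>x\<rceil> - 1" using assms(2) by simp
  moreover have "0 < x" by (simp add: x_def)
  \<comment> \<open>Positivity of \<open>x\<close> makes its ceiling at least 1, so the subtraction
    on natural numbers does not truncate.\<close>
  ultimately have "real m \<le> real_of_int \<lceil>x\<rceil> - 1" by linarith
  then have "real m < x" by linarith
  then have "real m * 2 powr (\<alpha> * real j) < x * 2 powr (\<alpha> * real j)"
    by (rule mult_strict_right_mono) simp
  moreover have "r_pt \<alpha> (j, m, l, k) = 2 powr (real j - 1) + real m * 2 powr (\<alpha> * real j)"
    using assms(1) by (simp add: r_pt_def)
  moreover have "2 powr (real j - 1) + x * 2 powr (\<alpha> * real j) = 2 powr real j"
    unfolding x_def by (rule scale_split)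
  ultimately show ?thesis by linarith
qed

text \<open>This is what the case distinction in \<^const>\<open>m_max\<close> is for: at scale \<open>j\<close> the radius
  stays below \<open>2\<^sup>j\<close> along every direction that reappears at scale \<open>j + 1\<close>, and below
  \<open>2\<^bsup>j+1\<^esup>\<close> along all others.\<close>

lemma polar_eq_imp_scale_le:
  assumes "\<alpha> < 1"
    and i: "(j, m, l, k) \<in> index_set \<alpha> \<beta> jmax" and i': "(j', m', l', k') \<in> index_set \<alpha> \<beta> jmax"
    and r: "r_pt \<alpha> (j, m, l, k) = r_pt \<alpha> (j', m', l', k')"
    and th: "theta_pt \<beta> (j, m, l, k) = theta_pt \<beta> (j', m', l', k')"
  shows "j' \<le> j"
proof (rule ccontr)
  assume "\<not> j' \<le> j"
  then have lt: "j < j'" by simp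
  have j': "2 powr (real j' - 1) \<le> r_pt \<alpha> (j', m', l', k')" using lt by (intro r_pt_ge) simp
  \<comment> \<open>The radius vanishes on the coarse layer. At adjacent scales, \<open>l'\<close>
    witnesses that the direction reappears, so the sharp bound applies. Two or more scales apart,
    the weaker bound 2^(j+1) suffices.\<close>
  consider "j = 0" | "1 \<le> j" "j' = j + 1" | "1 \<le> j" "j + 2 \<le> j'" using lt by linarith
  then show False
  proof cases
    case 1
    then have "r_pt \<alpha> (j, m, l, k) = 0" using i by (simp add: index_set_iff r_pt_def)
    then show False using r j' by (smt (verit) powr_gt_zero)
  next
    case 2
    have "r_pt \<alpha> (j, m, l, k) < 2 powr real j"
      using i i' th 2 by (intro r_pt_less_match[where l' = l' and \<beta> = \<beta> and jmax = jmax])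
        (auto simp: index_set_iff theta_pt_def)
    then show False using r j' 2 by simp
  next
    case 3
    have "r_pt \<alpha> (j, m, l, k) < 2 powr (real j + 1)"
      using assms(1) i 3 by (intro r_pt_less[where \<beta> = \<beta> and jmax = jmax]) (auto simp: index_set_iff)
    also have "\<dots> \<le> 2 powr (real j' - 1)" using 3 by simp
    finally show False using r j' by simp
  qed
qed

text \<open>The previous comparison, used in both directions, equates the scales. At a fixed scale
  the radius is strictly increasing in m and the angle in l.\<close>

lemma polar_inj:
  assumes "\<alpha> < 1"
    and i: "(j, m, l, k) \<in> index_set \<alpha> \<beta> jmax" and i': "(j', m', l', k') \<in> index_set \<alpha> \<beta> jmax"
    and r: "r_pt \<alpha> (j, m, l, k) = r_pt \<alpha> (j', m', l', k')"
    and th: "theta_pt \<beta> (j, m, l, k) = theta_pt \<beta> (j', m', l', k')"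
  shows "j = j' \<and> m = m' \<and> l = l'"
proof -
  have "j = j'"
    using polar_eq_imp_scale_le[OF assms(1) i i' r th]
      polar_eq_imp_scale_le[OF assms(1) i' i r[symmetric] th[symmetric]] by simp
  then show ?thesis
    using i i' r th by (auto simp: index_set_iff r_pt_def theta_pt_def theta_inj)
qed

section \<open>The polar part of the distance\<close>

definition polar_pt :: "real \<Rightarrow> real \<Rightarrow> wp_index \<Rightarrow> real \<times> real" where
  "polar_pt \<alpha> \<beta> i = (r_pt \<alpha> i, theta_pt \<beta> i)"

lemma finite_polar_pt: "finite (polar_pt \<alpha> \<beta> ` index_set \<alpha> \<beta> jmax)"
proof -
  \<comment> \<open>Radius and angle ignore the lattice point, so \<open>k\<close> may be replaced
    by the dummy value (0, 0) and the image factors through the finite set of triples.\<close>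
  have "polar_pt \<alpha> \<beta> ` index_set \<alpha> \<beta> jmax =
      (\<lambda>(j, m, l). polar_pt \<alpha> \<beta> (j, m, l, (0, 0))) ` (\<lambda>(j, m, l, k). (j, m, l)) ` index_set \<alpha> \<beta> jmax"
    unfolding image_image
    by (rule image_cong) (auto simp: polar_pt_def r_pt_def theta_pt_def)
  then show ?thesis using finite_index_triples by simp
qed

definition polar_dist :: "real \<Rightarrow> real \<Rightarrow> wp_index \<Rightarrow> wp_index \<Rightarrow> real" where
  "polar_dist \<alpha> \<beta> i i' = \<bar>r_pt \<alpha> i - r_pt \<alpha> i'\<bar> + \<bar>theta_pt \<beta> i - theta_pt \<beta> i'\<bar>"

text \<open>Finiteness serves twice: it gives an upper bound for the localisation estimate and a
  least positive value for the separation.\<close>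

lemma finite_polar_dist:
  "finite ((\<lambda>(i, i'). polar_dist \<alpha> \<beta> i i') ` (index_set \<alpha> \<beta> jmax \<times> index_set \<alpha> \<beta> jmax))"
proof -
  let ?P = "polar_pt \<alpha> \<beta> ` index_set \<alpha> \<beta> jmax"
  have "(\<lambda>(i, i'). polar_dist \<alpha> \<beta> i i') ` (index_set \<alpha> \<beta> jmax \<times> index_set \<alpha> \<beta> jmax)
      \<subseteq> (\<lambda>(p, q). \<bar>fst p - fst q\<bar> + \<bar>snd p - snd q\<bar>) ` (?P \<times> ?P)"
    by (force simp: polar_pt_def polar_dist_def)
  then show ?thesis by (rule finite_subset) (simp add: finite_polar_pt)
qed

section \<open>Separation and the metric axioms\<close>

lemma rho_le:
  "rho \<alpha> \<beta> \<delta> i i' \<le> polar_dist \<alpha> \<beta> i i' + 2 * norm (t_pt \<alpha> \<beta> \<delta> i - t_pt \<alpha> \<beta> \<delta> i')"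
  using component_le_norm_cart[of "t_pt \<alpha> \<beta> \<delta> i - t_pt \<alpha> \<beta> \<delta> i'" 1]
    component_le_norm_cart[of "t_pt \<alpha> \<beta> \<delta> i - t_pt \<alpha> \<beta> \<delta> i'" 2]
  unfolding rho_def polar_dist_def by linarith

lemma rho_ge:
  "polar_dist \<alpha> \<beta> i i' + norm (t_pt \<alpha> \<beta> \<delta> i - t_pt \<alpha> \<beta> \<delta> i') \<le> rho \<alpha> \<beta> \<delta> i i'"
  using norm_le_l1_cart[of "t_pt \<alpha> \<beta> \<delta> i - t_pt \<alpha> \<beta> \<delta> i'"]
  unfolding rho_def polar_dist_def sum_2 by linarith

text \<open>If the polar distance is positive, it is at least its smallest positive value. If it is
  zero, the triples coincide and the lattice spacing takes over.\<close>

lemma rho_separated: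
  assumes "\<alpha> < 1" "\<beta> < 1" "0 < \<delta>"
  shows "\<exists>e>0. \<forall>i\<in>index_set \<alpha> \<beta> jmax. \<forall>i'\<in>index_set \<alpha> \<beta> jmax. i \<noteq> i' \<longrightarrow> e \<le> rho \<alpha> \<beta> \<delta> i i'"
proof -
  let ?I = "index_set \<alpha> \<beta> jmax"
  \<comment> \<open>The added element 1 keeps \<open>S\<close> nonempty even if no positive polar
    distance occurs, so that \<open>Min S\<close> is meaningful.\<close>
  define S where "S = insert 1 ((\<lambda>(i, i'). polar_dist \<alpha> \<beta> i i') ` (?I \<times> ?I) \<inter> {0<..})"
  define e where "e = min (Min S) (\<delta> / 2 ^ jmax)"
  have S: "finite S" "S \<noteq> {}" "\<And>s. s \<in> S \<Longrightarrow> 0 < s"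
    using finite_polar_dist[of \<alpha> \<beta> jmax] by (auto simp: S_def)
  then have "0 < Min S" by simp
  then have "0 < e" using assms by (simp add: e_def)
  moreover have "e \<le> rho \<alpha> \<beta> \<delta> i i'" if "i \<in> ?I" "i' \<in> ?I" "i \<noteq> i'" for i i'
  proof (cases "polar_dist \<alpha> \<beta> i i' = 0")
    case True
    obtain j m l k where i: "i = (j, m, l, k)" by (cases i)
    obtain j' m' l' k' where i': "i' = (j', m', l', k')" by (cases i')
    have eq: "j = j'" "m = m'" "l = l'"
      using True polar_inj[OF assms(1), of j m l k \<beta> jmax j' m' l' k'] that
      by (auto simp: polar_dist_def i i')
    have "\<delta> / 2 ^ jmax \<le> norm (t_pt \<alpha> \<beta> \<delta> i - t_pt \<alpha> \<beta> \<delta> i')"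
      using norm_t_pt_diff_ge[of \<alpha> \<beta> \<delta> j m l k jmax k'] assms that by (simp add: i i' eq)
    then show ?thesis using rho_ge[of \<alpha> \<beta> i i' \<delta>] True by (simp add: e_def)
  next
    case False
    then have "polar_dist \<alpha> \<beta> i i' \<in> S" using that by (auto simp: S_def polar_dist_def)
    then have "e \<le> polar_dist \<alpha> \<beta> i i'" using S by (simp add: e_def min.coboundedI1)
    then show ?thesis using rho_ge[of \<alpha> \<beta> i i' \<delta>]
        norm_ge_zero[of "t_pt \<alpha> \<beta> \<delta> i - t_pt \<alpha> \<beta> \<delta> i'"] by linarith
  qed
  ultimately show ?thesis by blast
qed

lemma Metric_space_rho:
  assumes "\<alpha> < 1" "\<beta> < 1" "0 < \<delta>"
  shows "Metric_space (index_set \<alpha> \<beta> jmax) (rho \<alpha> \<beta> \<delta>)"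
proof
  show "0 \<le> rho \<alpha> \<beta> \<delta> i i'" for i i' by (simp add: rho_def)
  show "rho \<alpha> \<beta> \<delta> i i' = rho \<alpha> \<beta> \<delta> i' i" for i i' by (simp add: rho_def abs_minus_commute)
  show "(rho \<alpha> \<beta> \<delta> i i' = 0) = (i = i')"
    if "i \<in> index_set \<alpha> \<beta> jmax" "i' \<in> index_set \<alpha> \<beta> jmax" for i i'
  proof
    assume "rho \<alpha> \<beta> \<delta> i i' = 0"
    \<comment> \<open>Definiteness is read off from separation: distinct indices are a positive
      distance apart.\<close>
    then show "i = i'" using rho_separated[OF assms, of jmax] that by fastforce
  qed (simp add: rho_def)
  show "rho \<alpha> \<beta> \<delta> i i'' \<le> rho \<alpha> \<beta> \<delta> i i' + rho \<alpha> \<beta> \<delta> i' i''" for i i' i''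
  proof -
    have tri: "\<bar>a - c\<bar> \<le> \<bar>a - b\<bar> + \<bar>b - c\<bar>" for a b c :: real by simp
    have "rho \<alpha> \<beta> \<delta> i i'' \<le>
        (\<bar>r_pt \<alpha> i - r_pt \<alpha> i'\<bar> + \<bar>r_pt \<alpha> i' - r_pt \<alpha> i''\<bar>)
      + (\<bar>theta_pt \<beta> i - theta_pt \<beta> i'\<bar> + \<bar>theta_pt \<beta> i' - theta_pt \<beta> i''\<bar>)
      + (\<bar>t_pt \<alpha> \<beta> \<delta> i $ 1 - t_pt \<alpha> \<beta> \<delta> i' $ 1\<bar> + \<bar>t_pt \<alpha> \<beta> \<delta> i' $ 1 - t_pt \<alpha> \<beta> \<delta> i'' $ 1\<bar>)
      + (\<bar>t_pt \<alpha> \<beta> \<delta> i $ 2 - t_pt \<alpha> \<beta> \<delta> i' $ 2\<bar> + \<bar>t_pt \<alpha> \<beta> \<delta> i' $ 2 - t_pt \<alpha> \<beta> \<delta> i'' $ 2\<bar>)"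
      unfolding rho_def vector_minus_component by (intro add_mono tri)
    also have "\<dots> = rho \<alpha> \<beta> \<delta> i i' + rho \<alpha> \<beta> \<delta> i' i''"
      unfolding rho_def vector_minus_component by (simp only: ac_simps)
    finally show ?thesis .
  qed
qed

section \<open>Cardinality and embedding of the index set\<close>

lemma infinite_index_set: "infinite (index_set \<alpha> \<beta> jmax)"
proof
  assume "finite (index_set \<alpha> \<beta> jmax)"
  then have "finite (range (\<lambda>k. (0, 0, 0, k)) :: wp_index set)"
    by (rule rev_finite_subset) (auto simp: index_set_iff)
  then have "finite (UNIV :: (int \<times> int) set)"
    by (rule finite_imageD) (auto simp: inj_on_def)
  then show False by (simp add: finite_prod infinite_UNIV_int)
qed

lemma vector_5:
  "(vector [a, b, c, d, e] :: ('a::zero)^5) $ 1 = a"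
  "(vector [a, b, c, d, e] :: ('a::zero)^5) $ 2 = b"
  "(vector [a, b, c, d, e] :: ('a::zero)^5) $ 3 = c"
  "(vector [a, b, c, d, e] :: ('a::zero)^5) $ 4 = d"
  "(vector [a, b, c, d, e] :: ('a::zero)^5) $ 5 = e"
  unfolding vector_def by simp_all

lemma inj_index_embedding: "inj index_embedding"
proof (rule injI)
  fix i i' assume eq: "index_embedding i = index_embedding i'"
  obtain j m l k1 k2 where i: "i = (j, m, l, k1, k2)" by (cases i)
  obtain j' m' l' k1' k2' where i': "i' = (j', m', l', k1', k2')" by (cases i')
  have "index_embedding i $ n = index_embedding i' $ n" for n
    using eq by simp
  from this[of 1] this[of 2] this[of 3] this[of 4] this[of 5] show "i = i'"
    unfolding i i' index_embedding_def prod.case by (simp add: vector_5)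
qed

section \<open>Decay of wave packets\<close>

lemma decay_power:
  fixes f :: "real^2 \<Rightarrow> complex"
  assumes "bdd_above (range (\<lambda>t. (1 + norm t) powr \<kappa>0 * norm (f t)))" "12 \<le> \<kappa>0"
  shows "\<exists>C\<ge>0. \<forall>t. norm (f t) \<le> C * inverse ((1 + norm t) ^ 12)"
proof -
  obtain C where C: "\<And>t. (1 + norm t) powr \<kappa>0 * norm (f t) \<le> C"
    using assms(1) by (auto simp: bdd_above_def)
  have "norm (f t) \<le> C * inverse ((1 + norm t) ^ 12)" for t
  proof -
    have pos: "0 < 1 + norm t" by (simp add: add_pos_nonneg)
    have "(1 + norm t) ^ 12 = (1 + norm t) powr 12" using pos by (simp add: powr_numeral)
    also have "\<dots> \<le> (1 + norm t) powr \<kappa>0" using assms(2) by (intro powr_mono) auto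
    finally have "(1 + norm t) ^ 12 * norm (f t) \<le> C"
      by (meson C mult_right_mono norm_ge_zero order_trans)
    then show ?thesis using pos by (simp add: field_simps)
  qed
  \<comment> \<open>The bound dominates a nonnegative value at the origin.\<close>
  moreover have "0 \<le> C"
    using C[of 0] by (auto intro: order_trans[rotated])
  ultimately show ?thesis by blast
qed

text \<open>The modulation has modulus 1. Rotations keep lengths and dilations do not shrink them,
  so the argument of \<psi> is at least as long as \<open>s\<close>. The normalising factor is at
  most 2^j, since the determinant is at most its square.\<close>

lemma wave_packet_decay:
  assumes "0 \<le> \<alpha>" "0 \<le> \<beta>" "\<alpha> \<le> 1" "\<beta> \<le> 1"
    and C: "0 \<le> C" "\<And>t. norm (\<gamma> t) \<le> C * inverse ((1 + norm t) ^ 12)"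
      "\<And>t. norm (\<psi> t) \<le> C * inverse ((1 + norm t) ^ 12)"
    and i: "i \<in> index_set \<alpha> \<beta> jmax"
  shows "norm (wave_packet \<alpha> \<beta> \<delta> \<gamma> \<psi> i t) \<le>
    2 ^ jmax * C * inverse ((1 + norm (t - t_pt \<alpha> \<beta> \<delta> i)) ^ 12)"
proof -
  obtain j m l k where ieq: "i = (j, m, l, k)" by (cases i)
  define s where "s = t - t_pt \<alpha> \<beta> \<delta> i"
  define D where "D = C * inverse ((1 + norm s) ^ 12)"
  have D: "0 \<le> D" using C by (simp add: D_def)
  show ?thesis
  proof (cases "j = 0")
    case True
    then have "wave_packet \<alpha> \<beta> \<delta> \<gamma> \<psi> i t = \<gamma> s"
      using i by (simp add: ieq index_set_iff wave_packet_def s_def t_pt_def)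
    then have "norm (wave_packet \<alpha> \<beta> \<delta> \<gamma> \<psi> i t) \<le> 1 * D" using C(2)[of s] by (simp add: D_def)
    \<comment> \<open>The factor is inserted only to give the coarse layer the same constant as the
      other scales.\<close>
    also have "\<dots> \<le> 2 ^ jmax * D" using D by (intro mult_right_mono) auto
    finally show ?thesis by (simp add: D_def s_def mult.assoc)
  next
    case False
    define u where "u = A_mat \<alpha> \<beta> j *v (matrix_inv (R_mat \<beta> j l) *v s)"
    have "norm s \<le> norm u"
      using norm_le_norm_A_mat[OF assms(1,2), of "matrix_inv (R_mat \<beta> j l) *v s" j]
      by (simp add: u_def)
    then have u: "C * inverse ((1 + norm u) ^ 12) \<le> D"
      unfolding D_def using C(1)
      by (intro mult_left_mono le_imp_inverse_le power_mono zero_less_power add_pos_nonneg) auto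
    have "\<alpha> * real j \<le> real j" "\<beta> * real j \<le> real j"
      using mult_right_mono[OF assms(3), of "real j"] mult_right_mono[OF assms(4), of "real j"]
      by simp_all
    then have "\<bar>det (A_mat \<alpha> \<beta> j)\<bar> \<le> 2 powr (real j + real j)"
      by (simp add: det_2 A_mat_def flip: powr_add)
    also have "\<dots> = (2 ^ j)\<^sup>2"
      unfolding powr_add by (simp add: powr_realpow power2_eq_square)
    finally have "sqrt \<bar>det (A_mat \<alpha> \<beta> j)\<bar> \<le> sqrt ((2 ^ j)\<^sup>2)"
      by (rule real_sqrt_le_mono)
    also have "\<dots> = 2 ^ j" by simp
    also have "\<dots> \<le> 2 ^ jmax" using i by (auto simp: ieq index_set_iff)
    finally have det: "sqrt \<bar>det (A_mat \<alpha> \<beta> j)\<bar> \<le> 2 ^ jmax" .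
    have "norm (wave_packet \<alpha> \<beta> \<delta> \<gamma> \<psi> i t) = sqrt \<bar>det (A_mat \<alpha> \<beta> j)\<bar> * norm (\<psi> u)"
      using False by (simp add: ieq wave_packet_def norm_mult norm_exp u_def s_def t_pt_def)
    also have "\<dots> \<le> 2 ^ jmax * D"
      using det order_trans[OF C(3) u] by (intro mult_mono) auto
    finally show ?thesis by (simp add: D_def s_def mult.assoc)
  qed
qed

lemma continuous_wave_packet:
  assumes "continuous_on UNIV \<gamma>" "continuous_on UNIV \<psi>"
  shows "continuous_on UNIV (wave_packet \<alpha> \<beta> \<delta> \<gamma> \<psi> i)"
proof -
  obtain j m l k where ieq: "i = (j, m, l, k)" by (cases i)
  have lin: "continuous_on UNIV (\<lambda>t. M *v f t)" if "continuous_on UNIV f"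
    for M :: "real^2^2" and f :: "real^2 \<Rightarrow> real^2"
    using continuous_on_compose2[OF matrix_vector_mult_linear_continuous_on that] by auto
  have "continuous_on UNIV (\<lambda>t. \<gamma> (t - a))" for a
    by (rule continuous_on_compose2[OF assms(1)]) (intro continuous_intros | simp)+
  moreover have "continuous_on UNIV (\<lambda>t. \<psi> (M *v (M' *v (t - a))))" for M M' :: "real^2^2" and a
    by (rule continuous_on_compose2[OF assms(2) lin[OF lin]]) (intro continuous_intros | simp)+
  ultimately show ?thesis
    by (cases "(j, m, l) = (0, 0, 0)") (auto simp: wave_packet_def ieq intro!: continuous_intros)
qed

section \<open>Intrinsic localisation of the wave packet system\<close>

theorem theorem2:
  fixes \<alpha> \<beta> \<delta> p0 \<kappa>0 \<epsilon> \<kappa> \<kappa>1 \<kappa>2 :: real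
    and jmax :: nat
    and \<gamma> \<psi> :: "real^2 \<Rightarrow> complex"
  assumes "0 \<le> \<beta>" "\<beta> \<le> \<alpha>" "\<alpha> < 1"
    and "1 \<le> jmax"
    and "0 < \<delta>"
    and "0 < p0" "p0 \<le> 1"
    and "\<kappa>0 = 10 + 2 * inverse p0"
    and "0 < \<epsilon>" "\<epsilon> < 1 / 32"
    and "10 \<le> \<kappa>" "2 \<le> \<kappa>1" "10 \<le> \<kappa>2"
    and "\<forall>f\<in>{\<gamma>, \<psi>}. C_k 1 f"
    and "\<forall>f\<in>{\<gamma>, \<psi>}. \<forall>a. multi_size a \<le> 1 \<longrightarrow> in_L1 (multi_deriv a f) \<and> in_L_infinity (multi_deriv a f)"
    and "\<forall>f\<in>{\<gamma>, \<psi>}. bdd_above (range (\<lambda>t. (1 + norm t) powr \<kappa>0 * norm (f t)))"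
    and "\<forall>f\<in>{\<gamma>, \<psi>}. C_infinity (fourier f)"
    and "\<forall>\<xi>\<in>cball 0 4. fourier \<gamma> \<xi> \<noteq> 0"
    and "\<forall>\<xi>. \<xi> $ 1 \<in> {- \<epsilon>..1 + \<epsilon>} \<and> \<xi> $ 2 \<in> {- 1 - \<epsilon>..1 + \<epsilon>} \<longrightarrow> fourier \<psi> \<xi> \<noteq> 0"
    and "\<forall>f\<in>{\<gamma>, \<psi>}. fourier_decay \<kappa> \<kappa>1 \<kappa>2 f"
  shows "intrinsically_localised index_embedding (index_set \<alpha> \<beta> jmax) (rho \<alpha> \<beta> \<delta>)
           (wave_packet \<alpha> \<beta> \<delta> \<gamma> \<psi>)"
proof -
  let ?I = "index_set \<alpha> \<beta> jmax" and ?\<rho> = "rho \<alpha> \<beta> \<delta>" and ?W = "wave_packet \<alpha> \<beta> \<delta> \<gamma> \<psi>"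
    and ?t = "t_pt \<alpha> \<beta> \<delta>"
  have ab: "0 \<le> \<alpha>" "0 \<le> \<beta>" "\<alpha> < 1" "\<beta> < 1" using assms(1-3) by auto
  \<comment> \<open>Since p0 is at most 1, its inverse is at least 1, and 10 + 2 = 12 powers of
    decay are available.\<close>
  have "12 \<le> \<kappa>0" using assms(6-8) by (simp add: one_le_inverse_iff)
  then obtain C1 C2 where C1: "C1 \<ge> 0" "\<And>t. norm (\<gamma> t) \<le> C1 * inverse ((1 + norm t) ^ 12)"
    and C2: "C2 \<ge> 0" "\<And>t. norm (\<psi> t) \<le> C2 * inverse ((1 + norm t) ^ 12)"
    using decay_power[of \<kappa>0 \<gamma>] decay_power[of \<kappa>0 \<psi>] assms(16) by auto
  define C where "C = 2 ^ jmax * max C1 C2"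
  have dec: "norm (?W i t) \<le> C * inverse ((1 + norm (t - ?t i)) ^ 12)" if "i \<in> ?I" for i t
    unfolding C_def
  proof (rule wave_packet_decay[OF _ _ _ _ _ _ _ that])
    show "norm (\<gamma> t) \<le> max C1 C2 * inverse ((1 + norm t) ^ 12)" for t
      by (rule order_trans[OF C1(2)]) (auto intro!: mult_right_mono)
    show "norm (\<psi> t) \<le> max C1 C2 * inverse ((1 + norm t) ^ 12)" for t
      by (rule order_trans[OF C2(2)]) (auto intro!: mult_right_mono)
  qed (use ab C1 in auto)
  have cont: "continuous_on UNIV \<gamma>" "continuous_on UNIV \<psi>"
    using assms(14) by (auto intro!: differentiable_imp_continuous_on simp: differentiable_on_def)
  have L2: "\<forall>i\<in>?I. in_L2 (?W i)"
    using in_L2_of_decay[OF dec continuous_wave_packet[OF cont]] by simp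
  obtain e where e: "0 < e" "\<forall>i\<in>?I. \<forall>i'\<in>?I. i \<noteq> i' \<longrightarrow> e \<le> ?\<rho> i i'"
    using rho_separated[OF ab(3,4) assms(5), of jmax] by blast
  \<comment> \<open>Two distinct indices make the set of pairs nonempty, as a lower bound of a real
    infimum requires.\<close>
  have "(0, 0, 0, (0, 0)) \<in> ?I" "(0, 0, 0, (0, 1)) \<in> ?I" by (simp_all add: index_set_iff)
  then have "{(i, i'). i \<in> ?I \<and> i' \<in> ?I \<and> i \<noteq> i'} \<noteq> {}" by fastforce
  then have "e \<le> (INF (i, i') \<in> {(i, i'). i \<in> ?I \<and> i' \<in> ?I \<and> i \<noteq> i'}. ?\<rho> i i')"
    using e(2) by (intro cINF_greatest) auto
  then have sep: "0 < (INF (i, i') \<in> {(i, i'). i \<in> ?I \<and> i' \<in> ?I \<and> i \<noteq> i'}. ?\<rho> i i')"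
    using e(1) by linarith
  obtain M where M: "\<And>i i'. i \<in> ?I \<Longrightarrow> i' \<in> ?I \<Longrightarrow> polar_dist \<alpha> \<beta> i i' \<le> M"
    using bdd_above_finite[OF finite_polar_dist[of \<alpha> \<beta> jmax]] unfolding bdd_above_def by fast
  define K where "K = C\<^sup>2 * (LINT t|(lborel :: (real^2) measure). inverse ((1 + norm t) ^ 4))"
  have K: "0 \<le> K" unfolding K_def by (intro mult_nonneg_nonneg integral_nonneg_AE) auto
  have loc: "norm (L2_inner (?W i) (?W i')) \<le> K * (2 + \<bar>M\<bar>) ^ 8 * (1 + ?\<rho> i i') powr (- 8)"
    if "i \<in> ?I" "i' \<in> ?I" for i i'
  proof -
    define d where "d = norm (?t i - ?t i')"
    have d: "0 \<le> d" by (simp add: d_def)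
    have r0: "0 \<le> ?\<rho> i i'" by (simp add: rho_def)
    have "?\<rho> i i' \<le> \<bar>M\<bar> + 2 * d"
      using rho_le[of \<alpha> \<beta> \<delta> i i'] M[OF that] by (simp add: d_def)
    \<comment> \<open>Expanding the right side gives 2 + |M| + 2d + |M|d; the absolute value keeps
      the last term nonnegative whatever the sign of \<open>M\<close>.\<close>
    then have "1 + ?\<rho> i i' \<le> (2 + \<bar>M\<bar>) * (1 + d)"
      using d mult_nonneg_nonneg[of "\<bar>M\<bar>" d] unfolding ring_distribs by linarith
    then have "(1 + ?\<rho> i i') ^ 8 \<le> ((2 + \<bar>M\<bar>) * (1 + d)) ^ 8" using r0 by (intro power_mono) auto
    then have "inverse ((1 + d) ^ 8) \<le> (2 + \<bar>M\<bar>) ^ 8 * inverse ((1 + ?\<rho> i i') ^ 8)"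
      using r0 d unfolding power_mult_distrib
      by (subst inverse_eq_divide, subst pos_divide_le_eq) (simp_all add: divide_simps)
    then have "K * inverse ((1 + d) ^ 8) \<le> K * ((2 + \<bar>M\<bar>) ^ 8 * inverse ((1 + ?\<rho> i i') ^ 8))"
      using K by (rule mult_left_mono)
    moreover have "norm (L2_inner (?W i) (?W i')) \<le> K * inverse ((1 + d) ^ 8)"
      unfolding K_def d_def using dec that by (intro norm_L2_inner_le) auto
    moreover have "(1 + ?\<rho> i i') powr (- 8) = inverse ((1 + ?\<rho> i i') ^ 8)"
      using r0 by (simp add: powr_minus powr_numeral)
    ultimately show ?thesis by simp
  qed
  have "inj_on index_embedding ?I" using inj_index_embedding by (rule inj_on_subset) simp
  moreover have "countable ?I" by simp
  moreover have "\<exists>n::real. n > real DIM(real^5) \<and>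
      (\<exists>c. \<forall>i\<in>?I. \<forall>i'\<in>?I. norm (L2_inner (?W i) (?W i')) \<le> c * (1 + ?\<rho> i i') powr (- n))"
    \<comment> \<open>The exponent 8 exceeds the dimension 5 of the embedding space.\<close>
    by (rule exI[of _ 8], intro conjI exI[of _ "K * (2 + \<bar>M\<bar>) ^ 8"] ballI loc) simp
  ultimately show ?thesis
    unfolding intrinsically_localised_def
    using infinite_index_set Metric_space_rho[OF ab(3,4) assms(5)] sep L2 by blast
qed

end
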